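(* Let $V=\mathbb R^n$ and let $W\subseteq\bigwedge^r V$ be a linear subspace. Then for $0\le c\le r$, $$\frac{\dim\left(W\llcorner\bigwedge^c V^*\right)}{\binom{n}{r-c}}\ge\frac{\dim W}{\binom nr}.$$ Equality occurs only when $W=\{0\}$ or $W=\bigwedge^r V$.
   Context: Here $0\le r\le n$ and $c$ are integers, and $\bigwedge^r V$ denotes the $r$-th exterior power of $V$. $V^*$ is the dual of $V$, and $\bigwedge V^*$ is identified with the dual of the exterior algebra $\bigwedge V$: different degrees pair to zero, and $\langle v_1\wedge\dots\wedge v_k,\,w_1^*\wedge\dots\wedge w_k^*\rangle=\det(w_j^*(v_i))$ for $v_i\in V$, $w_j^*\in V^*$. The interior product $\llcorner:\bigwedge V\times\bigwedge V^*\to\bigwedge V$ is the bilinear map defined by $\langle v\llcorner w^*,u^*\rangle=\langle v,w^*\wedge u^*\rangle$ for all $v\in\bigwedge V$ and $w^*,u^*\in\bigwedge V^*$; it maps $\bigwedge^a V\times\bigwedge^b V^*$ into $\bigwedge^{a-b}V$ when $0\le b\le a\le n$. For linear subspaces $U\subseteq\bigwedge V$ and $W^*\subseteq\bigwedge V^*$, $U\llcorner W^*=\operatorname{span}\{u\llcorner w^*:u\in U,\ w^*\in W^*\}$.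
   Formalization: The equality clause is stated only for c > 0: for c = 0 contraction returns W itself, so equality holds for every W (e.g. a line in R^2 with r = 1) and the clause as printed fails; the inequality is kept for all 0 ≤ c ≤ r. *)

theory Defs
  imports "HOL-Analysis.Analysis" "Jordan_Normal_Form.Determinant"
begin

no_notation Matrix.vec_index (infixl "$" 100)
no_notation Matrix.scalar_prod (infix "\<bullet>" 70)
hide_const (open) Matrix.vec

text \<open>
  \<open>V\<close> is \<open>real ^ 'n\<close>, so \<open>n = CARD('n)\<close>; the linear order on \<open>'n\<close> is the order of the coordinates.
  The library has no exterior algebra. It is built here on the standard basis
  \<open>e\<^sub>S = e\<^bsub>s1\<^esub> \<and> \<dots> \<and> e\<^bsub>sk\<^esub>\<close>, where \<open>S = {s1 < \<dots> < sk}\<close> ranges over the subsets of \<open>'n\<close>, and the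
  theorem \<open>ext_universal\<close> below shows that the result has the universal property of the exterior
  algebra. The dual space \<open>V\<^sup>*\<close> is again \<open>real ^ 'n\<close>, written in the dual basis: \<open>w\<close> stands for the
  functional \<open>\<lambda>v. v \<bullet> w\<close>. Hence the exterior algebra of \<open>V\<^sup>*\<close> has the type \<open>'n ext\<close> as well.
\<close>

type_synonym 'n ext = "real ^ ('n set)"

definition blade :: "'n::{finite,linorder} set \<Rightarrow> 'n ext" where
  "blade S = axis S 1"

text \<open>The sign of the permutation that sorts the elements of \<open>S\<close> followed by those of \<open>T\<close>.\<close>

definition blade_sign :: "'n::{finite,linorder} set \<Rightarrow> 'n set \<Rightarrow> real" where
  "blade_sign S T = (-1) ^ card {(s, t). s \<in> S \<and> t \<in> T \<and> t < s}"

definition wedge :: "'n::{finite,linorder} ext \<Rightarrow> 'n ext \<Rightarrow> 'n ext" where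
  "wedge x y = (\<Sum>S\<in>UNIV. \<Sum>T\<in>UNIV. (x $ S * y $ T) *\<^sub>R
     (if S \<inter> T = {} then blade_sign S T *\<^sub>R blade (S \<union> T) else 0))"

definition ext_vec :: "real ^ 'n::{finite,linorder} \<Rightarrow> 'n ext" where
  "ext_vec v = (\<Sum>i\<in>UNIV. (v $ i) *\<^sub>R blade {i})"

text \<open>\<open>wedges [v1, \<dots>, vk] = v1 \<and> \<dots> \<and> vk\<close>, with the unit \<open>blade {}\<close> as the empty product.\<close>

definition wedges :: "(real ^ 'n::{finite,linorder}) list \<Rightarrow> 'n ext" where
  "wedges vs = foldr (\<lambda>v x. wedge (ext_vec v) x) vs (blade {})"

definition ext_power :: "nat \<Rightarrow> 'n::{finite,linorder} ext set" where
  "ext_power k = span {wedges vs | vs. length vs = k}"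

text \<open>
  The pairing in which the bases \<open>e\<^sub>S\<close> of the two exterior algebras are dual. It is the pairing given by
  determinants on products of vectors: see \<open>pairing_wedges\<close> and \<open>pairing_ext_power\<close>.
\<close>

definition pairing :: "'n::{finite,linorder} ext \<Rightarrow> 'n ext \<Rightarrow> real" where
  "pairing x y = (\<Sum>S\<in>UNIV. x $ S * y $ S)"

definition interior_product :: "'n::{finite,linorder} ext \<Rightarrow> 'n ext \<Rightarrow> 'n ext" where
  "interior_product x w = (THE z. \<forall>u. pairing z u = pairing x (wedge w u))"

definition contraction :: "'n::{finite,linorder} ext set \<Rightarrow> 'n ext set \<Rightarrow> 'n ext set" where
  "contraction U W = span {interior_product u w | u w. u \<in> U \<and> w \<in> W}"

subsection \<open>The exterior algebra\<close>

lemma wedges_Nil: "wedges [] = blade {}"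
  and wedges_Cons: "wedges (v # vs) = wedge (ext_vec v) (wedges vs)"
  by (simp_all add: wedges_def)

lemma blade_nth: "blade S $ T = (if S = T then 1 else 0)"
  by (simp add: blade_def axis_def)

lemma ext_expand: "x = (\<Sum>S\<in>UNIV. (x $ S) *\<^sub>R blade S)"
proof -
  have "(\<Sum>S\<in>UNIV. (x $ S) *\<^sub>R blade S) $ T = x $ T" for T
  proof -
    have "(\<Sum>S\<in>UNIV. (x $ S) *\<^sub>R blade S) $ T = (\<Sum>S\<in>UNIV. if S = T then x $ S else 0)"
      unfolding sum_component by (intro sum.cong refl) (simp add: blade_nth)
    then show ?thesis by simp
  qed
  then show ?thesis by (simp add: Finite_Cartesian_Product.vec_eq_iff)
qed

lemma linear_wedge_right: "linear (wedge x)"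
  by (rule linearI)
    (simp_all add: wedge_def algebra_simps sum.distrib scaleR_sum_right)

lemma linear_wedge_left: "linear (\<lambda>x. wedge x y)"
  by (rule linearI)
    (simp_all add: wedge_def algebra_simps sum.distrib scaleR_sum_right)

lemma linear_ext_vec: "linear ext_vec"
  by (rule linearI) (simp_all add: ext_vec_def algebra_simps sum.distrib scaleR_sum_right)

lemma ext_vec_axis: "ext_vec (axis i 1) = blade {i}"
  by (simp add: ext_vec_def axis_def Finite_Cartesian_Product.vec_eq_iff if_distrib[of "\<lambda>x. x * _"] if_distrib[of "\<lambda>x. x *\<^sub>R _"] cong: if_cong)

lemma wedge_blade:
  "wedge (blade S) (blade T) = (if S \<inter> T = {} then blade_sign S T *\<^sub>R blade (S \<union> T) else 0)"
proof -
  let ?g = "\<lambda>S T. if S \<inter> T = {} then blade_sign S T *\<^sub>R blade (S \<union> T) else 0"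
  have "wedge (blade S) (blade T) = (\<Sum>A\<in>UNIV. \<Sum>B\<in>UNIV. if A = S then if B = T then ?g A B else 0 else 0)"
    unfolding wedge_def by (intro sum.cong refl) (auto simp: blade_nth)
  also have "\<dots> = ?g S T"
    by (subst sum.swap) simp
  finally show ?thesis .
qed

lemma ext_linear_eq:
  assumes "linear f" "linear g" "\<And>S. f (blade S) = g (blade S)"
  shows "f x = g (x :: 'n::{finite,linorder} ext)"
proof -
  have "f (\<Sum>S\<in>UNIV. (x $ S) *\<^sub>R blade S) = g (\<Sum>S\<in>UNIV. (x $ S) *\<^sub>R blade S)"
    using assms by (simp add: linear_sum linear_cmul)
  then show ?thesis using ext_expand[of x] by simp
qed

lemma vec_linear_eq:
  assumes "linear f" "linear g" "\<And>i. f (axis i 1) = g (axis i 1)"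
  shows "f x = g (x :: real ^ 'n)"
  by (rule linear_eq_stdbasis[THEN fun_cong, OF assms(1,2)])
    (use assms(3) in \<open>auto simp: Basis_vec_def\<close>)

lemma blade_sign_Un_left:
  assumes "S \<inter> T = {}"
  shows "blade_sign (S \<union> T) U = blade_sign S U * blade_sign T U"
proof -
  have "{(s, t). s \<in> S \<union> T \<and> t \<in> U \<and> t < s} =
    {(s, t). s \<in> S \<and> t \<in> U \<and> t < s} \<union> {(s, t). s \<in> T \<and> t \<in> U \<and> t < s}" by auto
  then show ?thesis unfolding blade_sign_def power_add[symmetric]
    using assms by (auto intro!: arg_cong[of _ _ "\<lambda>k. (-1) ^ k"] card_Un_disjoint)
qed

lemma blade_sign_Un_right:
  assumes "T \<inter> U = {}"
  shows "blade_sign S (T \<union> U) = blade_sign S T * blade_sign S U"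
proof -
  have "{(s, t). s \<in> S \<and> t \<in> T \<union> U \<and> t < s} =
    {(s, t). s \<in> S \<and> t \<in> T \<and> t < s} \<union> {(s, t). s \<in> S \<and> t \<in> U \<and> t < s}" by auto
  then show ?thesis unfolding blade_sign_def power_add[symmetric]
    using assms by (auto intro!: arg_cong[of _ _ "\<lambda>k. (-1) ^ k"] card_Un_disjoint)
qed

lemma blade_sign_empty [simp]: "blade_sign {} T = 1" "blade_sign S {} = 1"
  by (simp_all add: blade_sign_def)

lemma blade_sign_single: "blade_sign {i} {j} = (if j < i then -1 else 1)"
proof -
  have "{(s, t). s \<in> {i} \<and> t \<in> {j} \<and> t < s} = (if j < i then {(i, j)} else {})" by auto
  then show ?thesis by (simp add: blade_sign_def)
qed

lemma blade_sign_insert: "j \<notin> S \<Longrightarrow> blade_sign {i} (insert j S) = blade_sign {i} {j} * blade_sign {i} S"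
  using blade_sign_Un_right[of "{j}" S "{i}"] by simp

lemma blade_sign_square: "blade_sign S T * blade_sign S T = 1"
  by (simp add: blade_sign_def flip: power_mult_distrib)

lemma wedge_zero [simp]: "wedge 0 y = 0" "wedge x 0 = 0"
  by (simp_all add: wedge_def)

lemma wedge_scaleR [simp]: "wedge (a *\<^sub>R x) y = a *\<^sub>R wedge x y" "wedge x (a *\<^sub>R y) = a *\<^sub>R wedge x y"
  using linear_cmul[OF linear_wedge_left] linear_cmul[OF linear_wedge_right] by auto

lemma wedge_unit [simp]: "wedge (blade {}) y = y" "wedge x (blade {}) = x"
  by (rule ext_linear_eq[of _ "\<lambda>x. x"]; simp add: linear_wedge_left linear_wedge_right linear_ident wedge_blade)+

lemma wedge_assoc: "wedge (wedge x y) z = wedge x (wedge y z)"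
proof -
  have 1: "wedge (wedge (blade S) (blade T)) (blade U) = wedge (blade S) (wedge (blade T) (blade U))"
    for S T U :: "'a set"
    by (auto simp: wedge_blade blade_sign_Un_left blade_sign_Un_right Int_Un_distrib Int_Un_distrib2 Un_assoc)
  have 2: "wedge (wedge (blade S) (blade T)) z = wedge (blade S) (wedge (blade T) z)"
    for S T :: "'a set" and z
    by (rule ext_linear_eq[where x = z], rule linear_wedge_right)
      (auto intro: 1 linear_compose[OF linear_wedge_right linear_wedge_right, unfolded o_def])
  have 3: "wedge (wedge (blade S) y) z = wedge (blade S) (wedge y z)" for S :: "'a set" and y z
    by (rule ext_linear_eq[where x = y])
      (auto intro: 2 linear_compose[OF linear_wedge_right linear_wedge_left, unfolded o_def]
         linear_compose[OF linear_wedge_left linear_wedge_right, unfolded o_def])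
  show ?thesis
    by (rule ext_linear_eq[where x = x])
      (auto intro: 3 linear_wedge_left linear_compose[OF linear_wedge_left linear_wedge_left, unfolded o_def])
qed

lemma wedge_single_blade:
  "wedge (blade {i}) (blade S) = (if i \<in> S then 0 else blade_sign {i} S *\<^sub>R blade (insert i S))"
  by (simp add: wedge_blade)

lemma ext_vec_square: "wedge (ext_vec v) (ext_vec v) = 0"
proof -
  let ?t = "wedge (ext_vec v) (ext_vec v)"
  have eq: "?t = (\<Sum>i\<in>UNIV. \<Sum>j\<in>UNIV. (v $ i * v $ j) *\<^sub>R wedge (blade {i}) (blade {j}))"
    unfolding ext_vec_def
    by (simp add: linear_sum[OF linear_wedge_left] linear_sum[OF linear_wedge_right] scaleR_sum_right)
      (subst sum.swap, simp add: mult.commute)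
  also have "\<dots> = (\<Sum>i\<in>UNIV. \<Sum>j\<in>UNIV. - ((v $ j * v $ i) *\<^sub>R wedge (blade {j}) (blade {i})))"
    by (intro sum.cong refl) (auto simp: wedge_single_blade blade_sign_single insert_commute)
  also have "\<dots> = - ?t"
    unfolding eq sum_negf by (rule arg_cong[of _ _ uminus], rule sum.swap)
  finally show ?thesis by (simp add: Finite_Cartesian_Product.vec_eq_iff)
qed


lemma blade_eq_wedges: "\<exists>vs. length vs = card S \<and> wedges vs = blade S"
proof (induction S rule: finite_linorder_min_induct[OF finite])
  case 1
  show ?case by (intro exI[of _ "[]"]) (simp add: wedges_Nil)
next
  case (2 b A)
  then obtain vs where vs: "length vs = card A" "wedges vs = blade A" by blast
  have "{(s, t). s \<in> {b} \<and> t \<in> A \<and> t < s} = {}" using 2(2) by force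
  then have "blade_sign {b} A = 1" unfolding blade_sign_def by (simp only: card.empty power_0)
  moreover have "b \<notin> A" using 2(2) by auto
  ultimately show ?case using vs
    by (intro exI[of _ "axis b 1 # vs"]) (simp add: wedges_Cons ext_vec_axis wedge_single_blade)
qed

lemma blade_in_ext_power: "blade S \<in> ext_power (card S)"
  unfolding ext_power_def using blade_eq_wedges[of S] by (auto intro!: span_base) metis

lemma subspace_homogeneous: "subspace {x :: 'n::{finite,linorder} ext. \<forall>S. card S \<noteq> k \<longrightarrow> x $ S = 0}"
  by (auto intro!: subspaceI)

lemma wedge_ext_vec_homogeneous:
  assumes "\<And>S. card S \<noteq> k \<Longrightarrow> x $ S = 0" "card T \<noteq> Suc k"
  shows "wedge (ext_vec v) x $ T = 0"
proof -
  have "wedge (blade {i}) x $ T = 0" for i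
  proof -
    have "wedge (blade {i}) x = (\<Sum>S\<in>UNIV. (x $ S) *\<^sub>R wedge (blade {i}) (blade S))"
      by (subst (1) ext_expand[of x]) (simp add: linear_sum[OF linear_wedge_right])
    also have "\<dots> $ T = 0"
      unfolding Finite_Cartesian_Product.sum_component
    proof (intro sum.neutral ballI)
      fix S
      show "((x $ S) *\<^sub>R wedge (blade {i}) (blade S)) $ T = 0"
        using assms by (cases "card S = k") (auto simp: wedge_single_blade blade_nth)
    qed
    finally show ?thesis .
  qed
  then show ?thesis
    by (simp add: ext_vec_def linear_sum[OF linear_wedge_left])
qed

lemma wedges_homogeneous: "card S \<noteq> length vs \<Longrightarrow> wedges vs $ S = 0"
proof (induction vs arbitrary: S)
  case Nil
  then show ?case by (auto simp: wedges_Nil blade_nth)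
next
  case (Cons v vs)
  then show ?case using wedge_ext_vec_homogeneous[of "length vs" "wedges vs" S v]
    by (simp add: wedges_Cons)
qed

lemma ext_power_eq: "ext_power k = {x. \<forall>S. card S \<noteq> k \<longrightarrow> x $ S = 0}"
proof
  show "ext_power k \<subseteq> {x :: 'a ext. \<forall>S. card S \<noteq> k \<longrightarrow> x $ S = 0}"
    unfolding ext_power_def
    by (rule span_minimal[OF _ subspace_homogeneous]) (auto simp: wedges_homogeneous)
  show "{x :: 'a ext. \<forall>S. card S \<noteq> k \<longrightarrow> x $ S = 0} \<subseteq> ext_power k"
  proof safe
    fix x :: "'a ext" assume x: "\<forall>S. card S \<noteq> k \<longrightarrow> x $ S = 0"
    have sub: "subspace (ext_power k :: 'a ext set)" by (simp add: ext_power_def)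
    have "(x $ S) *\<^sub>R blade S \<in> ext_power k" for S
      using x blade_in_ext_power[of S] subspace_scale[OF sub] subspace_0[OF sub]
      by (cases "card S = k") auto
    then have "(\<Sum>S\<in>UNIV. (x $ S) *\<^sub>R blade S) \<in> ext_power k"
      by (intro subspace_sum[OF sub])
    then show "x \<in> ext_power k" using ext_expand[of x] by simp
  qed
qed

lemma dim_ext_power: "dim (ext_power k :: 'n::{finite,linorder} ext set) = CARD('n) choose k"
proof -
  let ?B = "blade ` {S :: 'n set. card S = k}"
  have inj: "inj (blade :: 'n set \<Rightarrow> _)"
    by (rule injI) (metis blade_nth zero_neq_one)
  have "dim (ext_power k :: 'n ext set) = card ?B"
  proof (rule dim_unique)
    show "?B \<subseteq> ext_power k" using blade_in_ext_power by blast
    show "ext_power k \<subseteq> span ?B"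
    proof
      fix x :: "'n ext" assume x: "x \<in> ext_power k"
      have "(x $ S) *\<^sub>R blade S \<in> span ?B" for S
        using x by (cases "card S = k") (auto simp: ext_power_eq span_zero intro: span_scale span_base)
      then have "(\<Sum>S\<in>UNIV. (x $ S) *\<^sub>R blade S) \<in> span ?B" by (intro span_sum)
      then show "x \<in> span ?B" using ext_expand[of x] by simp
    qed
    have "?B \<subseteq> Basis" by (auto simp: Basis_vec_def blade_def)
    then show "independent ?B" using independent_Basis independent_mono by blast
  qed simp
  also have "\<dots> = card {S :: 'n set. card S = k}"
    by (rule card_image) (use inj in \<open>auto intro: inj_on_subset\<close>)
  also have "\<dots> = CARD('n) choose k"
    using n_subsets[of "UNIV :: 'n set" k] by simp
  finally show ?thesis .
qed

theorem ext_universal: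
  fixes f :: "real ^ 'n::{finite,linorder} \<Rightarrow> 'a::real_algebra_1"
  assumes "linear f" and sq: "\<And>v. f v * f v = 0"
  shows "\<exists>!F. linear F \<and> F (blade {}) = 1 \<and> (\<forall>x y. F (wedge x y) = F x * F y) \<and> (\<forall>v. F (ext_vec v) = f v)"
proof (rule ex_ex1I)
  define g where "g S = prod_list (map (\<lambda>i. f (axis i 1)) (sorted_list_of_set S))" for S :: "'n set"
  define F where "F x = (\<Sum>S\<in>UNIV. (x $ S) *\<^sub>R g S)" for x :: "'n ext"
  have anti: "f u * f v = - (f v * f u)" for u v
  proof -
    have "0 = f (u + v) * f (u + v)" by (simp add: sq)
    also have "\<dots> = f u * f v + f v * f u"
      by (simp add: linear_add[OF assms(1)] algebra_simps sq)
    finally show ?thesis by (simp add: eq_neg_iff_add_eq_0)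
  qed
  have g_min: "g (insert b A) = f (axis b 1) * g A" if "\<forall>a\<in>A. b < a" for b A
  proof -
    have "b \<notin> A" using that by auto
    then have "sorted_list_of_set (insert b A) = b # sorted_list_of_set A"
      using that by (simp add: insort_is_Cons less_imp_le)
    then show ?thesis by (simp add: g_def)
  qed
  have sign_min: "blade_sign {i} A = 1" if "\<forall>a\<in>A. i < a" for i :: 'n and A
  proof -
    have "{(s, t). s \<in> {i} \<and> t \<in> A \<and> t < s} = {}" using that by force
    then show ?thesis unfolding blade_sign_def by (simp only: card.empty power_0)
  qed
  have g_mult: "f (axis i 1) * g S = (if i \<in> S then 0 else blade_sign {i} S *\<^sub>R g (insert i S))" for i S
  proof (induction S rule: finite_linorder_min_induct[OF finite])
    case 1
    show ?case by (simp add: g_def)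
  next
    case (2 b A)
    have bA: "b \<notin> A" using 2(2) by auto
    consider "i = b" | "i < b" | "b < i" by (rule linorder_cases) auto
    then show ?case
    proof cases
      case 1
      have "f (axis i 1) * g (insert b A) = (f (axis b 1) * f (axis b 1)) * g A"
        using 1 g_min[OF 2(2)] by (simp add: mult.assoc)
      then show ?thesis using 1 by (simp add: sq)
    next
      case i: 2
      then have "\<forall>a\<in>insert b A. i < a" using 2(2) by auto
      then show ?thesis using g_min[of "insert b A" i] sign_min[of "insert b A" i] by auto
    next
      case 3
      have "f (axis i 1) * g (insert b A) = - (f (axis b 1) * (f (axis i 1) * g A))"
        using g_min[OF 2(2)] anti[of "axis i 1" "axis b 1"] by (simp flip: mult.assoc)
      also have "\<dots> = (if i \<in> A then 0 else - (blade_sign {i} A *\<^sub>R (f (axis b 1) * g (insert i A))))"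
        by (simp add: 2(3))
      also have "f (axis b 1) * g (insert i A) = g (insert b (insert i A))"
        using g_min[of "insert i A" b] 2(2) 3 by auto
      finally show ?thesis
        using 3 bA by (auto simp: blade_sign_insert blade_sign_single insert_commute)
    qed
  qed
  have linF: "linear F"
    by (rule linearI) (simp_all add: F_def algebra_simps sum.distrib scaleR_sum_right)
  have F_blade: "F (blade S) = g S" for S
  proof -
    have "F (blade S) = (\<Sum>T\<in>UNIV. if S = T then g T else 0)"
      unfolding F_def by (intro sum.cong refl) (simp add: blade_nth)
    then show ?thesis by simp
  qed
  have F_vec: "F (ext_vec v) = f v" for v
    by (rule vec_linear_eq[OF linear_compose[OF linear_ext_vec linF, unfolded o_def] assms(1)])
      (simp add: ext_vec_axis F_blade g_def)
  have F_mult1: "F (wedge (ext_vec v) y) = f v * F y" for v y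
  proof (rule vec_linear_eq[where x = v])
    show "linear (\<lambda>v. F (wedge (ext_vec v) y))"
      by (intro linear_compose[OF linear_ext_vec linear_compose[OF linear_wedge_left linF], unfolded o_def])
    show "linear (\<lambda>v. f v * F y)"
      by (rule linearI) (simp_all add: linear_add[OF assms(1)] linear_cmul[OF assms(1)] algebra_simps)
    show "F (wedge (ext_vec (axis i 1)) y) = f (axis i 1) * F y" for i
    proof (rule ext_linear_eq[where x = y])
      show "linear (\<lambda>y. F (wedge (ext_vec (axis i 1)) y))"
        by (intro linear_compose[OF linear_wedge_right linF, unfolded o_def])
      show "linear (\<lambda>y. f (axis i 1) * F y)"
        by (rule linearI) (simp_all add: linear_add[OF linF] linear_cmul[OF linF] algebra_simps)
      show "F (wedge (ext_vec (axis i 1)) (blade S)) = f (axis i 1) * F (blade S)" for S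
        by (simp add: ext_vec_axis wedge_single_blade F_blade g_mult linear_cmul[OF linF] linear_0[OF linF])
    qed
  qed
  have F_wedges: "F (wedge (wedges vs) y) = F (wedges vs) * F y" for vs y
    by (induction vs)
      (simp_all add: wedges_Nil wedges_Cons wedge_assoc F_mult1 F_blade g_def mult.assoc)
  have "F (wedge x y) = F x * F y" for x y
  proof (rule ext_linear_eq[where x = x])
    show "linear (\<lambda>x. F (wedge x y))"
      by (intro linear_compose[OF linear_wedge_left linF, unfolded o_def])
    show "linear (\<lambda>x. F x * F y)"
      by (rule linearI) (simp_all add: linear_add[OF linF] linear_cmul[OF linF] algebra_simps)
    show "F (wedge (blade S) y) = F (blade S) * F y" for S
      using blade_eq_wedges[of S] F_wedges by metis
  qed
  then show "\<exists>F. linear F \<and> F (blade {}) = 1 \<and> (\<forall>x y. F (wedge x y) = F x * F y) \<and> (\<forall>v. F (ext_vec v) = f v)"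
    using linF F_vec by (intro exI[of _ F]) (simp add: F_blade g_def)
next
  fix F G :: "'n ext \<Rightarrow> 'a"
  assume F: "linear F \<and> F (blade {}) = 1 \<and> (\<forall>x y. F (wedge x y) = F x * F y) \<and> (\<forall>v. F (ext_vec v) = f v)"
    and G: "linear G \<and> G (blade {}) = 1 \<and> (\<forall>x y. G (wedge x y) = G x * G y) \<and> (\<forall>v. G (ext_vec v) = f v)"
  have "F (wedges vs) = G (wedges vs)" for vs
    by (induction vs) (use F G in \<open>simp_all add: wedges_Nil wedges_Cons\<close>)
  then have "F (blade S) = G (blade S)" for S using blade_eq_wedges[of S] by metis
  then show "F = G" by (intro ext) (rule ext_linear_eq[OF conjunct1[OF F] conjunct1[OF G]])
qed

subsection \<open>The pairing and the interior product\<close>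

lemma pairing_inner: "pairing x y = x \<bullet> y"
  by (simp add: pairing_def inner_vec_def)

lemma pairing_blade: "pairing x (blade S) = x $ S"
  by (simp add: pairing_inner blade_def inner_axis)

lemma interior_product_unique:
  assumes "\<And>u. pairing z u = pairing x (wedge w u)"
  shows "interior_product x w = z"
  unfolding interior_product_def
proof (rule the_equality)
  show "\<forall>u. pairing z u = pairing x (wedge w u)" using assms by simp
  fix z' assume "\<forall>u. pairing z' u = pairing x (wedge w u)"
  then show "z' = z" using assms by (metis pairing_blade Finite_Cartesian_Product.vec_eq_iff)
qed

lemma pairing_interior_product: "pairing (interior_product x w) u = pairing x (wedge w u)"
proof -
  define z :: "'a ext" where "z = (\<chi> S. pairing x (wedge w (blade S)))"
  have "pairing z u = pairing x (wedge w u)" for u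
  proof (rule ext_linear_eq[where x = u])
    show "linear (pairing z)"
      by (rule linearI) (simp_all add: pairing_inner inner_right_distrib)
    show "linear (\<lambda>u. pairing x (wedge w u))"
      by (rule linearI)
        (simp_all add: pairing_inner inner_right_distrib linear_add[OF linear_wedge_right])
    show "pairing z (blade S) = pairing x (wedge w (blade S))" for S
      by (simp add: pairing_blade z_def)
  qed
  then show ?thesis using interior_product_unique[of z x w] by simp
qed

lemma interior_product_nth: "interior_product x w $ S = pairing x (wedge w (blade S))"
  by (metis pairing_blade pairing_interior_product)

lemma linear_interior_product_left: "linear (\<lambda>x. interior_product x w)"
  by (rule linearI)
    (simp_all add: Finite_Cartesian_Product.vec_eq_iff interior_product_nth pairing_inner inner_left_distrib)

lemma linear_interior_product_right: "linear (interior_product x)"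
  by (rule linearI)
    (simp_all add: Finite_Cartesian_Product.vec_eq_iff interior_product_nth pairing_inner inner_right_distrib
      linear_add[OF linear_wedge_left])

lemma pairing_ext_power:
  assumes "x \<in> ext_power j" "y \<in> ext_power k" "j \<noteq> k"
  shows "pairing x y = 0"
  unfolding pairing_def
proof (intro sum.neutral ballI)
  fix S
  show "x $ S * y $ S = 0" using assms by (cases "card S = j") (auto simp: ext_power_eq)
qed

lemma wedge_ext_power:
  assumes "x \<in> ext_power j" "y \<in> ext_power k"
  shows "wedge x y \<in> ext_power (j + k)"
proof -
  have sub: "subspace (ext_power m :: 'a ext set)" for m by (simp add: ext_power_def)
  show ?thesis unfolding wedge_def
  proof (intro subspace_sum[OF sub])
    fix S T
    show "(x $ S * y $ T) *\<^sub>R (if S \<inter> T = {} then blade_sign S T *\<^sub>R blade (S \<union> T) else 0)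
      \<in> ext_power (j + k)"
    proof (cases "S \<inter> T = {} \<and> card S = j \<and> card T = k")
      case True
      then have "card (S \<union> T) = j + k" by (simp add: card_Un_disjoint)
      then show ?thesis using True blade_in_ext_power[of "S \<union> T"]
        by (auto intro!: subspace_scale[OF sub])
    next
      case False
      then show ?thesis using assms subspace_0[OF sub] by (auto simp: ext_power_eq)
    qed
  qed
qed

lemma interior_product_ext_power:
  assumes "x \<in> ext_power a" "w \<in> ext_power b" "b \<le> a"
  shows "interior_product x w \<in> ext_power (a - b)"
  unfolding ext_power_eq
proof safe
  fix S :: "'a set" assume "card S \<noteq> a - b"
  then have "a \<noteq> b + card S" by auto
  then show "interior_product x w $ S = 0"
    unfolding interior_product_nth
    using pairing_ext_power assms(1) wedge_ext_power[OF assms(2) blade_in_ext_power] by blast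
qed

lemma interior_product_blade:
  "interior_product (blade S) (blade {j}) =
    (if j \<in> S then blade_sign {j} (S - {j}) *\<^sub>R blade (S - {j}) else 0)"
  unfolding Finite_Cartesian_Product.vec_eq_iff
proof
  fix T
  have "interior_product (blade S) (blade {j}) $ T =
      (if j \<in> T then 0 else blade_sign {j} T * (if insert j T = S then 1 else 0))"
    by (simp add: interior_product_nth wedge_single_blade pairing_inner)
      (simp add: blade_nth pairing_blade flip: pairing_inner)
  moreover have "insert j T = S \<and> j \<notin> T \<longleftrightarrow> j \<in> S \<and> S - {j} = T" by auto
  ultimately show "interior_product (blade S) (blade {j}) $ T =
      (if j \<in> S then blade_sign {j} (S - {j}) *\<^sub>R blade (S - {j}) else 0) $ T"
    by (cases "j \<in> S \<and> S - {j} = T") (auto simp: blade_nth)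
qed

lemma interior_product_wedge_ext_vec:
  "interior_product (wedge (ext_vec v) x) (ext_vec w) =
    (v \<bullet> w) *\<^sub>R x - wedge (ext_vec v) (interior_product x (ext_vec w))"
proof -
  note lin = linear_interior_product_left linear_interior_product_right linear_wedge_left
    linear_wedge_right linear_ext_vec
  have 1: "interior_product (wedge (blade {i}) (blade S)) (blade {j}) =
    (if i = j then 1 else 0) *\<^sub>R blade S - wedge (blade {i}) (interior_product (blade S) (blade {j}))"
    for i j :: 'a and S
  proof (cases "i = j")
    case True
    have "insert j (S - {j}) = S" if "j \<in> S" using that by auto
    then show ?thesis using True
      by (cases "j \<in> S") (simp_all add: wedge_single_blade interior_product_blade
        linear_cmul[OF lin(1)] linear_0[OF lin(1)] blade_sign_square)
  next
    case False
    consider "j \<notin> S" | "i \<in> S" "j \<in> S" | "i \<notin> S" "j \<in> S" by blast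
    then show ?thesis
    proof cases
      case 3
      define R where "R = S - {j}"
      have S: "S = insert j R" "insert i S - {j} = insert i R" "i \<notin> R" "j \<notin> R"
        using 3 False by (auto simp: R_def)
      have "blade_sign {i} {j} = - blade_sign {j} {i}"
        using False by (auto simp: blade_sign_single)
      then have "blade_sign {i} S * blade_sign {j} (insert i R) = - (blade_sign {j} R * blade_sign {i} R) * (blade_sign {j} {i} * blade_sign {j} {i})"
        unfolding S(1) blade_sign_insert[OF S(3)] blade_sign_insert[OF S(4)] by simp
      then have eq: "blade_sign {i} S * blade_sign {j} (insert i R) = - (blade_sign {j} R * blade_sign {i} R)"
        unfolding blade_sign_square by simp
      have "interior_product (wedge (blade {i}) (blade S)) (blade {j}) =
        (blade_sign {i} S * blade_sign {j} (insert i R)) *\<^sub>R blade (insert i R)"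
        using 3 by (simp add: wedge_single_blade linear_cmul[OF lin(1)] interior_product_blade S(2))
      moreover have "wedge (blade {i}) (interior_product (blade S) (blade {j})) =
        (blade_sign {j} R * blade_sign {i} R) *\<^sub>R blade (insert i R)"
        using 3 S(3) by (simp add: wedge_single_blade interior_product_blade flip: R_def)
      ultimately show ?thesis using False by (simp add: eq)
    qed (use False in \<open>simp_all add: wedge_single_blade interior_product_blade
        linear_cmul[OF lin(1)] linear_0[OF lin(1)]\<close>)
  qed
  have 2: "interior_product (wedge (blade {i}) x) (blade {j}) =
    (if i = j then 1 else 0) *\<^sub>R x - wedge (blade {i}) (interior_product x (blade {j}))"
    for i j :: 'a and x
  proof (rule ext_linear_eq[where x = x])
    show "linear (\<lambda>x. interior_product (wedge (blade {i}) x) (blade {j}))"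
      by (rule linear_compose[OF lin(4) lin(1), unfolded o_def])
    show "linear (\<lambda>x. (if i = j then 1 else 0) *\<^sub>R x - wedge (blade {i}) (interior_product x (blade {j})))"
      by (rule linear_compose_sub[OF linear_scale_self linear_compose[OF lin(1) lin(4), unfolded o_def]])
  qed (rule 1)
  have 3: "interior_product (wedge (ext_vec v) x) (blade {j}) =
    (v $ j) *\<^sub>R x - wedge (ext_vec v) (interior_product x (blade {j}))" for j
  proof (rule vec_linear_eq[where x = v])
    show "linear (\<lambda>v. interior_product (wedge (ext_vec v) x) (blade {j}))"
      by (intro linear_compose[OF lin(5) linear_compose[OF lin(3) lin(1)], unfolded o_def])
    show "linear (\<lambda>v. (v $ j) *\<^sub>R x - wedge (ext_vec v) (interior_product x (blade {j})))"
      by (intro linear_compose_sub linear_compose[OF lin(5) lin(3), unfolded o_def])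
        (rule linearI; simp add: algebra_simps)
    show "interior_product (wedge (ext_vec (axis i 1)) x) (blade {j}) =
      (axis i 1 $ j) *\<^sub>R x - wedge (ext_vec (axis i 1)) (interior_product x (blade {j}))" for i
    proof -
      have "axis i (1 :: real) $ j = (if i = j then 1 else 0)" by (simp add: axis_def)
      then show ?thesis by (simp add: ext_vec_axis 2)
    qed
  qed
  show ?thesis
  proof (rule vec_linear_eq[where x = w])
    show "linear (\<lambda>w. interior_product (wedge (ext_vec v) x) (ext_vec w))"
      by (intro linear_compose[OF lin(5) lin(2), unfolded o_def])
    show "linear (\<lambda>w. (v \<bullet> w) *\<^sub>R x - wedge (ext_vec v) (interior_product x (ext_vec w)))"
      by (intro linear_compose_sub
          linear_compose[OF lin(5) linear_compose[OF lin(2) lin(4)], unfolded o_def])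
        (rule linearI; simp add: algebra_simps inner_right_distrib)
    show "interior_product (wedge (ext_vec v) x) (ext_vec (axis j 1)) =
      (v \<bullet> axis j 1) *\<^sub>R x - wedge (ext_vec v) (interior_product x (ext_vec (axis j 1)))" for j
      by (simp add: ext_vec_axis 3 inner_axis)
  qed
qed

lemma interior_product_wedges:
  "interior_product (wedges vs) (ext_vec w) =
    (\<Sum>i<length vs. ((-1) ^ i * (vs ! i \<bullet> w)) *\<^sub>R wedges (take i vs @ drop (Suc i) vs))"
proof (induction vs)
  case Nil
  have "interior_product (blade {}) (ext_vec w) = 0"
    by (simp add: ext_vec_def linear_sum[OF linear_interior_product_right]
      linear_cmul[OF linear_interior_product_right] interior_product_blade)
  then show ?case by (simp add: wedges_Nil)
next
  case (Cons v vs)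
  then show ?case
    by (simp add: wedges_Cons interior_product_wedge_ext_vec sum.lessThan_Suc_shift
      linear_sum[OF linear_wedge_right] sum_negf del: sum.lessThan_Suc)
qed

theorem pairing_wedges:
  assumes "length vs = k" "length ws = k"
  shows "pairing (wedges vs) (wedges ws) = Determinant.det (Matrix.mat k k (\<lambda>(i, j). vs ! i \<bullet> ws ! j))"
  using assms
proof (induction ws arbitrary: vs k)
  case Nil
  then show ?case by (simp add: wedges_Nil pairing_blade blade_nth)
next
  case (Cons w ws)
  define A where "A = Matrix.mat k k (\<lambda>(i, j). vs ! i \<bullet> (w # ws) ! j)"
  have "pairing (wedges vs) (wedges (w # ws)) = pairing (interior_product (wedges vs) (ext_vec w)) (wedges ws)"
    by (simp add: pairing_interior_product wedges_Cons)
  also have "\<dots> = (\<Sum>i<k. (-1) ^ i * (vs ! i \<bullet> w) * pairing (wedges (take i vs @ drop (Suc i) vs)) (wedges ws))"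
    using Cons.prems by (simp add: interior_product_wedges pairing_inner inner_sum_left)
  also have "\<dots> = (\<Sum>i<k. A $$ (i, 0) * cofactor A i 0)"
  proof (intro sum.cong refl)
    fix i assume "i \<in> {..<k}"
    then have i: "i < k" by simp
    have "pairing (wedges (take i vs @ drop (Suc i) vs)) (wedges ws) =
      Determinant.det (Matrix.mat (k - 1) (k - 1) (\<lambda>(i', j). (take i vs @ drop (Suc i) vs) ! i' \<bullet> ws ! j))"
      by (rule Cons.IH) (use Cons.prems i in auto)
    also have "Matrix.mat (k - 1) (k - 1) (\<lambda>(i', j). (take i vs @ drop (Suc i) vs) ! i' \<bullet> ws ! j) = mat_delete A i 0"
      using Cons.prems i by (intro eq_matI) (auto simp: mat_delete_def A_def nth_append)
    finally show "(-1) ^ i * (vs ! i \<bullet> w) * pairing (wedges (take i vs @ drop (Suc i) vs)) (wedges ws) =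
      A $$ (i, 0) * cofactor A i 0"
      using i by (simp add: cofactor_def A_def)
  qed
  also have "\<dots> = Determinant.det A"
    using Cons.prems by (intro laplace_expansion_column[symmetric]) (auto simp: A_def)
  finally show ?case by (simp add: A_def)
qed

text \<open>
  Contracting with degree 0 changes nothing, so the dimension inequality is an equality for every \<open>W\<close>
  when \<open>c = 0\<close>. A characterization of the equality case therefore needs \<open>c > 0\<close>.
\<close>

lemma contraction_ext_power_0:
  assumes "subspace W"
  shows "contraction W (ext_power 0) = W"
proof -
  have 0: "ext_power 0 = span {blade {} :: 'a ext}"
    by (auto simp: ext_power_def wedges_Nil)
  have unit: "interior_product x (a *\<^sub>R blade {}) = a *\<^sub>R x" for a and x :: "'a ext"
    by (simp add: Finite_Cartesian_Product.vec_eq_iff interior_product_nth pairing_inner inner_scaleR_right)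
      (simp add: pairing_blade flip: pairing_inner)
  have "{interior_product u w |u w. u \<in> W \<and> w \<in> ext_power 0} = W"
  proof safe
    fix u w assume "u \<in> W" "w \<in> (ext_power 0 :: 'a ext set)"
    then show "interior_product u w \<in> W"
      unfolding 0 span_singleton using unit assms subspace_scale by auto
  next
    fix u assume "u \<in> W"
    then show "\<exists>u' w. u = interior_product u' w \<and> u' \<in> W \<and> w \<in> ext_power 0"
      unfolding 0 using unit[of u 1] by (intro exI[of _ u] exI[of _ "blade {}"]) (auto intro: span_base)
  qed
  then show ?thesis using assms by (simp add: contraction_def span_eq_iff)
qed

end

theory Submission
  imports Defs
begin

text \<open>
  Let \<open>a\<^sub>i\<close> be contraction with the basis covector \<open>e\<^sub>i\<close>. For the inner product that makes the basis blades
  orthonormal, its adjoint is multiplication by \<open>e\<^sub>i\<close>. On degree \<open>r\<close> the sum of \<open>a\<^sub>i\<^sup>* a\<^sub>i\<close> over \<open>i\<close> is the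
  scalar \<open>r\<close>, and on degree \<open>r - 1\<close> the sum of \<open>a\<^sub>i a\<^sub>i\<^sup>*\<close> is the scalar \<open>n - r + 1\<close>
  (\<open>sum_norm_contractions\<close>, \<open>sum_norm_wedges\<close>).

  The heart of the matter is \<open>c = 1\<close> (\<open>dim_contraction_1\<close>). Let \<open>U\<close> be the contraction of \<open>W\<close> with \<open>V\<^sup>*\<close>,
  and sum the squares of all matrix entries of all \<open>a\<^sub>i\<close>, taken from an orthonormal basis of \<open>W\<close> to one of
  \<open>U\<close>. Since \<open>a\<^sub>i\<close> maps \<open>W\<close> into \<open>U\<close>, summing over the basis of \<open>U\<close> first gives exactly \<open>r dim W\<close>.
  Summing over the basis of \<open>W\<close> first gives, by Bessel's inequality for the vectors \<open>e\<^sub>i \<and> u\<close>, at most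
  \<open>(n - r + 1) dim U\<close>. As \<open>r (n choose r) = (n - r + 1) (n choose (r - 1))\<close>, this is the claimed inequality.

  If equality holds, then it holds in each use of Bessel's inequality, so \<open>e\<^sub>i \<and> U \<subseteq> W\<close> for every \<open>i\<close>.
  Hence \<open>W\<close> is invariant under all \<open>a\<^sub>i\<^sup>* a\<^sub>j\<close>, that is, under the action of \<open>gl\<^sub>n\<close>. The exterior power is
  irreducible under this action (\<open>ext_power_irreducible\<close>), so \<open>W\<close> is \<open>0\<close> or everything.

  For larger \<open>c\<close> one contracts with one vector at a time: the density \<open>dim / binomial\<close> grows weakly at
  each step, so if the first and the last density agree, then already the first step is an equality.
\<close>

hide_const (open) Matrix.orthogonal
hide_fact (open) Matrix.orthogonal_def

section \<open>Orthonormal families\<close>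

text \<open>
  The square of the distance to the orthogonal projection. It yields both Bessel's inequality and its
  equality case.
\<close>

lemma orthonormal_residual:
  fixes x :: "'a::real_inner"
  assumes "finite B" and orth: "pairwise orthogonal B" and unit: "\<And>b. b \<in> B \<Longrightarrow> norm b = 1"
  shows "(norm (x - (\<Sum>b\<in>B. (x \<bullet> b) *\<^sub>R b)))\<^sup>2 = x \<bullet> x - (\<Sum>b\<in>B. (x \<bullet> b)\<^sup>2)"
proof -
  define p where "p = (\<Sum>b\<in>B. (x \<bullet> b) *\<^sub>R b)"
  have pb: "p \<bullet> b = x \<bullet> b" if b: "b \<in> B" for b
  proof -
    have "p \<bullet> b = (\<Sum>a\<in>B. (x \<bullet> a) * (a \<bullet> b))"
      by (simp add: p_def inner_sum_left)
    also have "\<dots> = (\<Sum>a\<in>B. if a = b then x \<bullet> b else 0)"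
    proof (intro sum.cong refl)
      fix a assume "a \<in> B"
      then show "(x \<bullet> a) * (a \<bullet> b) = (if a = b then x \<bullet> b else 0)"
        using orth unit[OF b] b by (auto simp: pairwise_def orthogonal_def dot_square_norm)
    qed
    also have "\<dots> = x \<bullet> b" using \<open>finite B\<close> b by simp
    finally show ?thesis .
  qed
  have xp: "x \<bullet> p = (\<Sum>b\<in>B. (x \<bullet> b)\<^sup>2)"
    by (simp add: p_def inner_sum_right power2_eq_square)
  have "p \<bullet> p = (\<Sum>b\<in>B. (x \<bullet> b) * (p \<bullet> b))"
    by (subst (2) p_def) (simp add: inner_sum_right)
  also have "\<dots> = (\<Sum>b\<in>B. (x \<bullet> b)\<^sup>2)"
    by (intro sum.cong) (simp_all add: pb power2_eq_square)
  finally have pp: "p \<bullet> p = (\<Sum>b\<in>B. (x \<bullet> b)\<^sup>2)" .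
  have "(norm (x - p))\<^sup>2 = x \<bullet> x - 2 * (x \<bullet> p) + p \<bullet> p"
    by (simp add: power2_norm_eq_inner inner_diff_left inner_diff_right inner_commute)
  then show ?thesis using xp pp by (simp add: p_def)
qed

lemma Bessel_inequality:
  fixes x :: "'a::real_inner"
  assumes "finite B" "pairwise orthogonal B" "\<And>b. b \<in> B \<Longrightarrow> norm b = 1"
  shows "(\<Sum>b\<in>B. (x \<bullet> b)\<^sup>2) \<le> x \<bullet> x"
  using orthonormal_residual[OF assms, of x] zero_le_power2[of "norm (x - (\<Sum>b\<in>B. (x \<bullet> b) *\<^sub>R b))"]
  by linarith

lemma Bessel_equality_iff:
  fixes x :: "'a::euclidean_space"
  assumes B: "finite B" "pairwise orthogonal B" "\<And>b. b \<in> B \<Longrightarrow> norm b = 1"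
  shows "(\<Sum>b\<in>B. (x \<bullet> b)\<^sup>2) = x \<bullet> x \<longleftrightarrow> x \<in> span B"
proof
  assume "(\<Sum>b\<in>B. (x \<bullet> b)\<^sup>2) = x \<bullet> x"
  then have "x = (\<Sum>b\<in>B. (x \<bullet> b) *\<^sub>R b)"
    using orthonormal_residual[OF B, of x] by simp
  also have "\<dots> \<in> span B"
    by (intro span_sum span_scale span_base)
  finally show "x \<in> span B" .
next
  assume "x \<in> span B"
  then have "(\<Sum>b\<in>B. (x \<bullet> b) *\<^sub>R b) = x"
    by (intro orthonormal_basis_expand[OF B(2)] B(1,3))
  then show "(\<Sum>b\<in>B. (x \<bullet> b)\<^sup>2) = x \<bullet> x"
    using orthonormal_residual[OF B, of x] by simp
qed

section \<open>Multiplication and contraction by a basis vector\<close>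

lemma inner_wedge_adjoint: "x \<bullet> wedge w y = interior_product x w \<bullet> y"
  using pairing_interior_product[of x w y] by (simp add: pairing_inner)

text \<open>
  The canonical anticommutation relation \<open>a\<^sub>i a\<^sub>i\<^sup>* + a\<^sub>i\<^sup>* a\<^sub>i = 1\<close>; it reduces norms of products with \<open>e\<^sub>i\<close>
  to norms of contractions.
\<close>

lemma anticommutation:
  "interior_product (wedge (blade {i}) x) (blade {i}) = x - wedge (blade {i}) (interior_product x (blade {i}))"
  using interior_product_wedge_ext_vec[of "axis i 1" x "axis i 1"]
  by (simp add: ext_vec_axis inner_axis_axis)

text \<open>
  The operators \<open>a\<^sub>i\<^sup>* a\<^sub>i\<close> are the coordinate projections onto the span of the blades that contain \<open>i\<close>.
  This gives the sums of norms below, and it isolates single blades in the proof of irreducibility.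
\<close>

lemma number_operator:
  "wedge (blade {i}) (interior_product x (blade {i})) = (\<chi> S. if i \<in> S then x $ S else 0)"
proof (rule ext_linear_eq[where x = x])
  show "linear (\<lambda>x. wedge (blade {i}) (interior_product x (blade {i})))"
    by (rule linear_compose[OF linear_interior_product_left linear_wedge_right, unfolded o_def])
  show "linear (\<lambda>x :: 'a ext. \<chi> S. if i \<in> S then x $ S else 0)"
    by (rule linearI) (auto simp: Finite_Cartesian_Product.vec_eq_iff)
  show "wedge (blade {i}) (interior_product (blade T) (blade {i})) = (\<chi> S. if i \<in> S then blade T $ S else 0)" for T
  proof (cases "i \<in> T")
    case True
    then have "insert i (T - {i}) = T" by auto
    then show ?thesis using True
      by (auto simp: interior_product_blade wedge_single_blade blade_sign_square blade_nth
          Finite_Cartesian_Product.vec_eq_iff)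
  next
    case False
    then show ?thesis
      by (auto simp: interior_product_blade blade_nth Finite_Cartesian_Product.vec_eq_iff)
  qed
qed

text \<open>A blade of degree \<open>r\<close> survives exactly \<open>r\<close> of the projections \<open>a\<^sub>i\<^sup>* a\<^sub>i\<close>.\<close>

lemma sum_norm_contractions:
  assumes "x \<in> ext_power r"
  shows "(\<Sum>i\<in>UNIV. interior_product x (blade {i}) \<bullet> interior_product x (blade {i})) = real r * (x \<bullet> x)"
proof -
  have "(\<Sum>i\<in>UNIV. interior_product x (blade {i}) \<bullet> interior_product x (blade {i}))
      = (\<Sum>i\<in>UNIV. \<Sum>S\<in>UNIV. if i \<in> S then x $ S * x $ S else 0)"
    unfolding inner_wedge_adjoint[symmetric] number_operator
    by (auto simp: inner_vec_def intro!: sum.cong)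
  also have "\<dots> = (\<Sum>S\<in>UNIV. \<Sum>i\<in>UNIV. if i \<in> S then x $ S * x $ S else 0)"
    by (rule sum.swap)
  also have "\<dots> = (\<Sum>S\<in>UNIV. real (card S) * (x $ S * x $ S))"
    by (intro sum.cong refl) (simp add: sum.If_cases)
  also have "\<dots> = (\<Sum>S\<in>UNIV. real r * (x $ S * x $ S))"
    using assms by (intro sum.cong refl) (auto simp: ext_power_eq)
  also have "\<dots> = real r * (x \<bullet> x)"
    by (simp add: inner_vec_def sum_distrib_left)
  finally show ?thesis .
qed

lemma sum_norm_wedges:
  fixes x :: "'n::{finite,linorder} ext"
  assumes "x \<in> ext_power s"
  shows "(\<Sum>i\<in>UNIV. wedge (blade {i}) x \<bullet> wedge (blade {i}) x) = (real CARD('n) - real s) * (x \<bullet> x)"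
proof -
  have "wedge (blade {i}) x \<bullet> wedge (blade {i}) x
      = x \<bullet> x - interior_product x (blade {i}) \<bullet> interior_product x (blade {i})" for i
  proof -
    have "wedge (blade {i}) x \<bullet> wedge (blade {i}) x = interior_product (wedge (blade {i}) x) (blade {i}) \<bullet> x"
      by (rule inner_wedge_adjoint)
    also have "\<dots> = x \<bullet> x - x \<bullet> wedge (blade {i}) (interior_product x (blade {i}))"
      unfolding anticommutation inner_diff_left by (metis inner_commute)
    finally show ?thesis by (simp add: inner_wedge_adjoint)
  qed
  then have "(\<Sum>i\<in>UNIV. wedge (blade {i}) x \<bullet> wedge (blade {i}) x)
      = (\<Sum>i\<in>(UNIV :: 'n set). x \<bullet> x) - real s * (x \<bullet> x)"
    by (simp only: sum_subtractf sum_norm_contractions[OF assms])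
  then show ?thesis by (simp add: algebra_simps)
qed

section \<open>Irreducibility of the exterior powers\<close>

text \<open>
  The operators \<open>a\<^sub>i\<^sup>* a\<^sub>i\<close> with \<open>i \<in> S\<close> cut a vector of \<open>W\<close> down to a multiple of \<open>blade S\<close>, because no
  other set of \<open>r\<close> elements contains \<open>S\<close>. The operators \<open>a\<^sub>i\<^sup>* a\<^sub>j\<close> then exchange an element \<open>j\<close> of \<open>S\<close>
  for an outside element \<open>i\<close>, and such exchanges lead from \<open>S\<close> to every set of the same size.
\<close>

lemma ext_power_irreducible:
  fixes W :: "'n::{finite,linorder} ext set"
  assumes W: "subspace W" "W \<subseteq> ext_power r"
    and closed: "\<And>i j w. w \<in> W \<Longrightarrow> wedge (blade {i}) (interior_product w (blade {j})) \<in> W"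
  shows "W = {0} \<or> W = ext_power r"
proof (cases "W \<subseteq> {0}")
  case True
  then show ?thesis using subspace_0[OF W(1)] by auto
next
  case False
  then obtain w where w: "w \<in> W" "w \<noteq> 0" by auto
  then obtain S where S: "w $ S \<noteq> 0" by (auto simp: Finite_Cartesian_Product.vec_eq_iff)
  have homogeneous: "w $ T = 0" if "card T \<noteq> r" for T
    using w W(2) that by (auto simp: ext_power_eq)
  then have cS: "card S = r" using S by auto
  have proj: "(\<chi> T. if A \<subseteq> T then w $ T else 0) \<in> W" for A
  proof (induction A rule: finite_induct[OF finite])
    case 1
    then show ?case using w by simp
  next
    case (2 i A)
    have "(\<chi> T. if insert i A \<subseteq> T then w $ T else 0) =
        wedge (blade {i}) (interior_product (\<chi> T. if A \<subseteq> T then w $ T else 0) (blade {i}))"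
      by (auto simp: number_operator Finite_Cartesian_Product.vec_eq_iff)
    then show ?case using closed[OF 2(3)] by simp
  qed
  have "(\<chi> T. if S \<subseteq> T then w $ T else 0) = (w $ S) *\<^sub>R blade S"
    unfolding Finite_Cartesian_Product.vec_eq_iff
  proof
    fix T
    have "S = T" if "S \<subseteq> T" "card T = r"
      using that cS by (intro card_subset_eq) auto
    then show "(\<chi> T. if S \<subseteq> T then w $ T else 0) $ T = ((w $ S) *\<^sub>R blade S) $ T"
      using homogeneous by (auto simp: blade_nth)
  qed
  then have "inverse (w $ S) *\<^sub>R ((w $ S) *\<^sub>R blade S) \<in> W"
    using subspace_scale[OF W(1) proj[of S]] by metis
  then have "blade S \<in> W" using S by simp
  have cancel_sign: "x \<in> W" if "blade_sign A D *\<^sub>R x \<in> W" for A D :: "'n set" and x :: "'n ext"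
    using subspace_scale[OF W(1) that, of "blade_sign A D"]
    by (simp only: scaleR_scaleR blade_sign_square scaleR_one)
  have blades: "blade T \<in> W" if "card T = r" for T
    using \<open>blade S \<in> W\<close> that cS
  proof (induction "card (T - S)" arbitrary: S)
    case 0
    then have "T \<subseteq> S" by simp
    then have "T = S" using 0 by (intro card_subset_eq) auto
    then show ?case using 0 by simp
  next
    case (Suc k)
    then have "T - S \<noteq> {}" by force
    then obtain i where i: "i \<in> T" "i \<notin> S" by auto
    have "card (S - T) = card (T - S)"
      using Suc.prems by (simp add: card_Diff_subset_Int Int_commute)
    then have "S - T \<noteq> {}" using Suc(2) by force
    then obtain j where j: "j \<in> S" "j \<notin> T" by auto
    define S' where "S' = insert i (S - {j})"
    have i': "i \<notin> S - {j}" using i by auto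
    have "blade_sign {j} (S - {j}) *\<^sub>R blade_sign {i} (S - {j}) *\<^sub>R blade S' \<in> W"
      using closed[OF Suc.prems(1), of i j] i j
      by (simp add: interior_product_blade wedge_single_blade S'_def)
    then have "blade S' \<in> W" by (rule cancel_sign[OF cancel_sign])
    moreover have "card S' = r"
      using Suc.prems i' j by (simp add: S'_def card_Suc_Diff1 del: card_Diff_insert)
    moreover have "T - S' = (T - S) - {i}" using i j by (auto simp: S'_def)
    then have "k = card (T - S')" using Suc(2) i by simp
    ultimately show ?case using Suc.hyps(1)[of S'] Suc.prems(2) by simp
  qed
  have "ext_power r \<subseteq> W"
  proof
    fix x :: "'n ext" assume x: "x \<in> ext_power r"
    have "(x $ T) *\<^sub>R blade T \<in> W" for T
      using x blades subspace_scale[OF W(1)] subspace_0[OF W(1)]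
      by (cases "card T = r") (auto simp: ext_power_eq)
    then have "(\<Sum>T\<in>UNIV. (x $ T) *\<^sub>R blade T) \<in> W" by (intro subspace_sum[OF W(1)])
    then show "x \<in> W" using ext_expand[of x] by simp
  qed
  then show ?thesis using W(2) by auto
qed

section \<open>Contraction by vectors\<close>

text \<open>
  The double count of the squared matrix entries \<open>(a\<^sub>i b \<bullet> u)\<^sup>2 = (b \<bullet> e\<^sub>i \<and> u)\<^sup>2\<close>, where \<open>b\<close> and \<open>u\<close> run through
  orthonormal bases of \<open>W\<close> and \<open>U\<close>.
\<close>

lemma dim_contraction_1:
  fixes W :: "'n::{finite,linorder} ext set"
  assumes W: "subspace W" "W \<subseteq> ext_power (Suc s)"
  defines "U \<equiv> contraction W (ext_power 1)"
  shows "real (Suc s) * real (dim W) \<le> (real CARD('n) - real s) * real (dim U)"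
    and "real (Suc s) * real (dim W) = (real CARD('n) - real s) * real (dim U) \<Longrightarrow>
      W = {0} \<or> W = ext_power (Suc s)"
proof -
  have subU: "subspace U" by (simp add: U_def contraction_def)
  have e1: "blade {i} \<in> ext_power 1" for i :: 'n
    using blade_in_ext_power[of "{i}"] by simp
  have WU: "interior_product w (blade {i}) \<in> U" if "w \<in> W" for w i
    unfolding U_def contraction_def using that e1 by (intro span_base) auto
  have Us: "U \<subseteq> ext_power s"
    unfolding U_def contraction_def
  proof (rule span_minimal)
    show "subspace (ext_power s :: 'n ext set)" by (simp add: ext_power_def)
    show "{interior_product u w |u w. u \<in> W \<and> w \<in> ext_power 1} \<subseteq> ext_power s"
      using interior_product_ext_power[of _ "Suc s" _ 1] W(2) by auto
  qed
  obtain B where B: "B \<subseteq> W" "pairwise orthogonal B" "\<And>b. b \<in> B \<Longrightarrow> norm b = 1"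
      "independent B" "card B = dim W" "span B = W"
    using orthonormal_basis_subspace[OF W(1)] by metis
  obtain C where C: "C \<subseteq> U" "pairwise orthogonal C" "\<And>b. b \<in> C \<Longrightarrow> norm b = 1"
      "independent C" "card C = dim U" "span C = U"
    using orthonormal_basis_subspace[OF subU] by metis
  have fin: "finite B" "finite C" using B(4) C(4) independent_imp_finite by auto
  have parseval: "(\<Sum>u\<in>C. (x \<bullet> u)\<^sup>2) = x \<bullet> x" if "x \<in> span C" for x
    using Bessel_equality_iff[OF fin(2) C(2,3)] that by blast
  define f where "f u i = (\<Sum>b\<in>B. (wedge (blade {i}) u \<bullet> b)\<^sup>2)" for u and i :: 'n
  have bessel: "f u i \<le> wedge (blade {i}) u \<bullet> wedge (blade {i}) u" for u i
    unfolding f_def by (rule Bessel_inequality[OF fin(1) B(2,3)])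
  have "real (Suc s) * real (dim W) = (\<Sum>b\<in>B. real (Suc s) * (b \<bullet> b))"
    using B(3,5) by (simp add: dot_square_norm)
  also have "\<dots> = (\<Sum>b\<in>B. \<Sum>i\<in>UNIV. interior_product b (blade {i}) \<bullet> interior_product b (blade {i}))"
    using B(1) W(2) by (intro sum.cong refl sum_norm_contractions[symmetric]) auto
  also have "\<dots> = (\<Sum>b\<in>B. \<Sum>i\<in>UNIV. \<Sum>u\<in>C. (interior_product b (blade {i}) \<bullet> u)\<^sup>2)"
  proof (intro sum.cong refl)
    fix b i assume "b \<in> B"
    then have "interior_product b (blade {i}) \<in> span C" using WU B(1) C(6) by auto
    then show "interior_product b (blade {i}) \<bullet> interior_product b (blade {i}) =
        (\<Sum>u\<in>C. (interior_product b (blade {i}) \<bullet> u)\<^sup>2)"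
      by (rule parseval[symmetric])
  qed
  also have "\<dots> = (\<Sum>b\<in>B. \<Sum>i\<in>UNIV. \<Sum>u\<in>C. (wedge (blade {i}) u \<bullet> b)\<^sup>2)"
    unfolding inner_wedge_adjoint[symmetric] by (simp add: inner_commute)
  also have "\<dots> = (\<Sum>b\<in>B. \<Sum>u\<in>C. \<Sum>i\<in>UNIV. (wedge (blade {i}) u \<bullet> b)\<^sup>2)"
    by (intro sum.cong refl sum.swap)
  also have "\<dots> = (\<Sum>u\<in>C. \<Sum>b\<in>B. \<Sum>i\<in>UNIV. (wedge (blade {i}) u \<bullet> b)\<^sup>2)"
    by (rule sum.swap)
  also have "\<dots> = (\<Sum>u\<in>C. \<Sum>i\<in>UNIV. f u i)"
    unfolding f_def by (intro sum.cong refl sum.swap)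
  finally have lhs: "real (Suc s) * real (dim W) = (\<Sum>u\<in>C. \<Sum>i\<in>UNIV. f u i)" .
  have "(real CARD('n) - real s) * real (dim U) = (\<Sum>u\<in>C. (real CARD('n) - real s) * (u \<bullet> u))"
    using C(3,5) by (simp add: dot_square_norm)
  also have "\<dots> = (\<Sum>u\<in>C. \<Sum>i\<in>UNIV. wedge (blade {i}) u \<bullet> wedge (blade {i}) u)"
    using C(1) Us by (intro sum.cong refl sum_norm_wedges[symmetric]) auto
  finally have rhs: "(real CARD('n) - real s) * real (dim U) =
      (\<Sum>u\<in>C. \<Sum>i\<in>UNIV. wedge (blade {i}) u \<bullet> wedge (blade {i}) u)" .
  show "real (Suc s) * real (dim W) \<le> (real CARD('n) - real s) * real (dim U)"
    unfolding lhs rhs by (intro sum_mono bessel)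
  assume "real (Suc s) * real (dim W) = (real CARD('n) - real s) * real (dim U)"
  then have "(\<Sum>u\<in>C. \<Sum>i\<in>UNIV. wedge (blade {i}) u \<bullet> wedge (blade {i}) u - f u i) = 0"
    unfolding lhs rhs by (simp add: sum_subtractf)
  then have eq: "wedge (blade {i}) u \<bullet> wedge (blade {i}) u = f u i" if "u \<in> C" for u i
    using that fin(2) bessel by (auto simp: sum_nonneg_eq_0_iff sum_nonneg)
  have CW: "wedge (blade {i}) u \<in> W" if "u \<in> C" for u i
    using Bessel_equality_iff[OF fin(1) B(2,3), of "wedge (blade {i}) u"] eq[OF that, of i] B(6)
    by (simp add: f_def)
  have "wedge (blade {i}) u \<in> W" if "u \<in> U" for u i
  proof -
    have "wedge (blade {i}) u \<in> wedge (blade {i}) ` span C" using that C(6) by auto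
    also have "\<dots> = span (wedge (blade {i}) ` C)"
      by (rule linear_span_image[OF linear_wedge_right, symmetric])
    also have "\<dots> \<subseteq> W" using CW W(1) by (intro span_minimal) auto
    finally show ?thesis .
  qed
  then show "W = {0} \<or> W = ext_power (Suc s)"
    using ext_power_irreducible[OF W] WU by blast
qed

lemma contraction_density_1:
  fixes W :: "'n::{finite,linorder} ext set"
  assumes W: "subspace W" "W \<subseteq> ext_power (Suc s)" and s: "s < CARD('n)"
  defines "U \<equiv> contraction W (ext_power 1)"
  shows "real (dim W) / real (CARD('n) choose Suc s) \<le> real (dim U) / real (CARD('n) choose s)"
    and "real (dim W) / real (CARD('n) choose Suc s) = real (dim U) / real (CARD('n) choose s) \<Longrightarrow>
      W = {0} \<or> W = ext_power (Suc s)"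
proof -
  let ?n = "CARD('n)"
  have "Suc s * (?n choose Suc s) = (?n - s) * (?n choose s)"
    by (simp only: binomial_absorption binomial_absorb_comp)
  then have "real (Suc s * (?n choose Suc s)) = real ((?n - s) * (?n choose s))"
    by (rule arg_cong)
  then have binom: "real (Suc s) * real (?n choose Suc s) = (real ?n - real s) * real (?n choose s)"
    using s by (simp only: of_nat_mult of_nat_diff less_imp_le)
  have pos: "real (?n choose Suc s) > 0" "real (?n choose s) > 0" "real ?n - real s > 0"
    using s by simp_all
  \<comment> \<open>Both binomial coefficients are multiples of \<open>q\<close>, which puts both densities over one denominator.\<close>
  define q where "q = real (?n choose s) / real (Suc s)"
  have q: "q > 0" "real (?n choose Suc s) = (real ?n - real s) * q" "real (?n choose s) = real (Suc s) * q"
    using binom pos by (simp_all add: q_def field_simps)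
  have W_density: "real (dim W) / real (?n choose Suc s) =
      (real (Suc s) * real (dim W)) / (real (Suc s) * (real ?n - real s) * q)"
    unfolding q(2) using q(1) pos by (simp add: field_simps del: of_nat_Suc)
  have U_density: "real (dim U) / real (?n choose s) =
      ((real ?n - real s) * real (dim U)) / (real (Suc s) * (real ?n - real s) * q)"
    unfolding q(3) using q(1) pos by (simp add: field_simps del: of_nat_Suc)
  have D: "real (Suc s) * (real ?n - real s) * q > 0" using q(1) pos by simp
  show "real (dim W) / real (?n choose Suc s) \<le> real (dim U) / real (?n choose s)"
    unfolding W_density U_density
    using dim_contraction_1(1)[OF W] D by (intro divide_right_mono) (auto simp: U_def)
  assume "real (dim W) / real (?n choose Suc s) = real (dim U) / real (?n choose s)"
  then show "W = {0} \<or> W = ext_power (Suc s)"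
    unfolding W_density U_density
    using dim_contraction_1(2)[OF W] D unfolding U_def by (metis divide_cancel_right less_irrefl)
qed

section \<open>Contraction by forms of higher degree\<close>

lemma interior_product_wedge:
  "interior_product x (wedge w y) = interior_product (interior_product x w) y"
  by (rule interior_product_unique) (simp add: pairing_interior_product wedge_assoc)

text \<open>
  Exterior powers are closed under products, so contracting twice stays inside the contraction by the
  total degree. This is what lets the densities be compared one vector at a time.
\<close>

lemma contraction_contraction_subset:
  "contraction (contraction W (ext_power a)) (ext_power b) \<subseteq> contraction W (ext_power (a + b))"
  unfolding contraction_def[of "contraction W (ext_power a)"]
proof (rule span_minimal)
  show sub: "subspace (contraction W (ext_power (a + b)))" by (simp add: contraction_def)
  show "{interior_product u w |u w. u \<in> contraction W (ext_power a) \<and> w \<in> ext_power b}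
      \<subseteq> contraction W (ext_power (a + b))"
  proof safe
    fix u y :: "'a ext" assume u: "u \<in> contraction W (ext_power a)" and y: "y \<in> ext_power b"
    let ?G = "{interior_product x w |x w. x \<in> W \<and> w \<in> ext_power a}"
    let ?f = "\<lambda>x. interior_product x y"
    have "?f (interior_product x w) \<in> contraction W (ext_power (a + b))"
      if "x \<in> W" "w \<in> ext_power a" for x w
      unfolding contraction_def interior_product_wedge[symmetric]
      using that wedge_ext_power[OF _ y] by (intro span_base) blast
    then have "?f ` ?G \<subseteq> contraction W (ext_power (a + b))" by (auto simp: image_subset_iff)
    then have "span (?f ` ?G) \<subseteq> contraction W (ext_power (a + b))"
      by (rule span_minimal[OF _ sub])
    moreover have "?f u \<in> ?f ` span ?G" using u by (auto simp: contraction_def)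
    ultimately show "?f u \<in> contraction W (ext_power (a + b))"
      using linear_span_image[OF linear_interior_product_left[of y], of ?G] by auto
  qed
qed

lemma contraction_ext_power:
  assumes "W \<subseteq> ext_power r" "c \<le> r"
  shows "contraction W (ext_power c) \<subseteq> ext_power (r - c)"
  unfolding contraction_def
  by (rule span_minimal)
    (use assms interior_product_ext_power[of _ r _ c] in \<open>auto simp: ext_power_def[of "r - c"]\<close>)

lemma contraction_density:
  fixes W :: "'n::{finite,linorder} ext set"
  assumes "r \<le> CARD('n)" "subspace W" "W \<subseteq> ext_power r" "c \<le> r"
  shows "real (dim W) / real (CARD('n) choose r)
    \<le> real (dim (contraction W (ext_power c))) / real (CARD('n) choose (r - c))"
  using assms
proof (induction c arbitrary: r W)
  case 0
  then show ?case by (simp add: contraction_ext_power_0)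
next
  case (Suc c)
  then obtain s where s: "r = Suc s" "s < CARD('n)" "c \<le> s" by (cases r) auto
  define U where "U = contraction W (ext_power 1)"
  have U: "subspace U" "U \<subseteq> ext_power s"
    using contraction_ext_power[of W r 1] Suc.prems s(1) by (simp_all add: U_def contraction_def)
  have "real (dim W) / real (CARD('n) choose r) \<le> real (dim U) / real (CARD('n) choose s)"
    using contraction_density_1(1)[of W s] Suc.prems s by (simp add: U_def)
  also have "\<dots> \<le> real (dim (contraction U (ext_power c))) / real (CARD('n) choose (s - c))"
    using Suc.IH[of s U] U s by simp
  also have "\<dots> \<le> real (dim (contraction W (ext_power (Suc c)))) / real (CARD('n) choose (s - c))"
    using dim_subset[OF contraction_contraction_subset[of W 1 c]]
    by (intro divide_right_mono) (simp_all add: U_def)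
  finally show ?case using s(1) by simp
qed

text \<open>
  Equality of the outer densities squeezes the density after contraction with one vector, so the
  equality case for \<open>c = 1\<close> applies.
\<close>

theorem theorem2p9:
  fixes W :: "'n::{finite,linorder} ext set" and r c :: nat
  assumes "r \<le> CARD('n)" and "subspace W" and "W \<subseteq> ext_power r" and "c \<le> r"
  shows "real (dim (contraction W (ext_power c))) / real (CARD('n) choose (r - c))
           \<ge> real (dim W) / real (CARD('n) choose r) \<and>
         (0 < c \<longrightarrow>
           real (dim (contraction W (ext_power c))) / real (CARD('n) choose (r - c))
             = real (dim W) / real (CARD('n) choose r) \<longrightarrow>
           W = {0} \<or> W = ext_power r)"
proof (intro conjI impI)
  show "real (dim W) / real (CARD('n) choose r)
      \<le> real (dim (contraction W (ext_power c))) / real (CARD('n) choose (r - c))"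
    by (rule contraction_density[OF assms])
next
  assume "0 < c" and eq: "real (dim (contraction W (ext_power c))) / real (CARD('n) choose (r - c))
    = real (dim W) / real (CARD('n) choose r)"
  then obtain d s where s: "c = Suc d" "r = Suc s" "s < CARD('n)" "d \<le> s"
    using assms by (cases c; cases r) auto
  define U where "U = contraction W (ext_power 1)"
  have U: "subspace U" "U \<subseteq> ext_power s"
    using contraction_ext_power[of W r 1] assms s(2) by (simp_all add: U_def contraction_def)
  have "real (dim U) / real (CARD('n) choose s)
      \<le> real (dim (contraction U (ext_power d))) / real (CARD('n) choose (s - d))"
    using contraction_density[of s U d] U s by simp
  also have "\<dots> \<le> real (dim (contraction W (ext_power c))) / real (CARD('n) choose (s - d))"
    using dim_subset[OF contraction_contraction_subset[of W 1 d]] s(1)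
    by (intro divide_right_mono) (simp_all add: U_def)
  also have "\<dots> = real (dim W) / real (CARD('n) choose Suc s)"
    using eq s by simp
  finally have "real (dim W) / real (CARD('n) choose Suc s) = real (dim U) / real (CARD('n) choose s)"
    using contraction_density_1(1)[of W s] assms s by (simp add: U_def)
  then show "W = {0} \<or> W = ext_power r"
    using contraction_density_1(2)[of W s] assms s by (simp add: U_def)
qed

end
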